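(* Let $m,n,k$ be integers with $0\le k\le \min(m,n)$, and suppose that $c_{m,n,k}(i,j)=0$ is a proper zero of $M(m,n,k)$. Then, among the entries of $M(m,n,k)$ adjacent (horizontally, vertically or diagonally) to this entry, zeros may occur only at the upper-right and lower-left positions. That is, in the $3\times 3$ submatrix of $M(m,n,k)$ centered at this entry, $$\left[\begin{array}{ccc} \bullet & \bullet & *\\ \bullet & 0 & \bullet\\ * & \bullet & \bullet \end{array}\right],$$ the six entries marked $\bullet$ are nonzero; equivalently, $c_{m,n,k}(i-1,j)$, $c_{m,n,k}(i-1,j+1)$, $c_{m,n,k}(i,j-1)$, $c_{m,n,k}(i,j+1)$, $c_{m,n,k}(i+1,j-1)$ and $c_{m,n,k}(i+1,j)$ are all nonzero.
   Context: The domain is the set of integer tuples $(m,n,k,i,j)$ with $0\le k\le\min(m,n)$, $0\le i\le m$, $0\le j\le n$, $0\le i+j-k\le m+n-2k$. On it define $$c_{m,n,k}(i,j)=\sum_{l=0}^{k}(-1)^l\binom{i+j-k}{i-l}\binom{m-l}{k-l}\binom{n-k+l}{l},$$ where $\binom{a}{b}=0$ if $b<0$ or $b>a$. The matrix $M(m,n,k)$ has $m+1$ rows and $m+n-2k+1$ columns; its entry in row $i+1$ and column $i+j-k+1$ is $c_{m,n,k}(i,j)$ when $0\le j\le n$, and is $0$ when $j<0$ (lower-left corner triangle) or $j>n$ (upper-right corner triangle). The polygon of $M(m,n,k)$ is the complement of the corner triangles, i.e. the set of positions with $(m,n,k,i,j)$ in the domain. A proper zero is a zero entry in the interior of the polygon,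 i.e. $0<i<m$, $0<j<n$, $0<i+j-k<m+n-2k$ and $c_{m,n,k}(i,j)=0$. *)

theory Defs
  imports Main "Jordan_Normal_Form.Matrix"
begin

text \<open>All parameters are integers, so that differences such as \<open>i - l\<close> are not truncated.
  The binomial coefficient vanishes outside \<open>0 \<le> b \<le> a\<close>; in particular it is
  \<open>0\<close> for \<open>a < 0\<close>, unlike the polynomial extension.\<close>

definition binom :: "int \<Rightarrow> int \<Rightarrow> int" where
  "binom a b = (if b < 0 \<or> b > a then 0 else int (nat a choose nat b))"

definition c :: "int \<Rightarrow> int \<Rightarrow> int \<Rightarrow> int \<Rightarrow> int \<Rightarrow> int" where
  "c m n k i j =
     (\<Sum>l=0..k. (-1) ^ nat l * binom (i + j - k) (i - l) * binom (m - l) (k - l) * binom (n - k + l) l)"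

text \<open>Library matrices are indexed from \<open>0\<close>, so row \<open>i + 1\<close> and column \<open>i + j - k + 1\<close> of the
  usual \<open>1\<close>-based numbering become row \<open>i\<close> and column \<open>i + j - k\<close>; the position \<open>(r, s)\<close>
  thus has \<open>i = r\<close> and \<open>j = s - r + k\<close>.\<close>

definition M :: "int \<Rightarrow> int \<Rightarrow> int \<Rightarrow> int mat" where
  "M m n k = mat (nat (m + 1)) (nat (m + n - 2 * k + 1))
     (\<lambda>(r, s). let i = int r; j = int s - int r + k
               in if 0 \<le> j \<and> j \<le> n then c m n k i j else 0)"

lemma M_entry:
  assumes "0 \<le> i" "i \<le> m" "0 \<le> j" "j \<le> n" "0 \<le> i + j - k" "i + j - k \<le> m + n - 2 * k"
  shows "M m n k $$ (nat i, nat (i + j - k)) = c m n k i j"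
  using assms by (simp add: M_def Let_def)

definition proper_zero :: "int \<Rightarrow> int \<Rightarrow> int \<Rightarrow> int \<Rightarrow> int \<Rightarrow> bool" where
  "proper_zero m n k i j \<longleftrightarrow>
     0 < i \<and> i < m \<and> 0 < j \<and> j < n \<and> 0 < i + j - k \<and> i + j - k < m + n - 2 * k \<and>
     c m n k i j = 0"

definition adjacent :: "nat \<times> nat \<Rightarrow> nat \<times> nat \<Rightarrow> bool" where
  "adjacent p q \<longleftrightarrow> p \<noteq> q \<and>
     \<bar>int (fst p) - int (fst q)\<bar> \<le> 1 \<and> \<bar>int (snd p) - int (snd q)\<bar> \<le> 1"

end

theory Submission
  imports Defs
begin

text \<open>Let \<open>e\<^sub>i = F\<^sup>i v\<close> and \<open>f\<^sub>j = F\<^sup>j v'\<close> be the standard bases of the Verma modules of \<open>sl\<^sub>2\<close>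
  with highest weights \<open>m\<close> and \<open>n\<close>. Then \<open>c m n k i j\<close> is the coefficient of \<open>e\<^sub>i \<otimes> f\<^sub>j\<close> in
  \<open>F\<^sup>s w\<close>, where \<open>s = i + j - k\<close> and \<open>w\<close> is the singular vector of weight \<open>m + n - 2 k\<close>. Applying \<open>F\<close>
  gives the Pascal recurrence, and applying \<open>E\<close> gives a second three-term recurrence.
  Entries of the polygon with \<open>i = 0\<close> or \<open>j = n\<close> do not vanish; on the other hand, the two recurrences
  propagate a pair of zeros \<open>c m n k i j = c m n k (i - 1) j = 0\<close> along the antidiagonal until it
  meets one of these edges. So no such pair exists, and the Pascal recurrence turns this into the
  claim for all six neighbours.\<close>

lemma binom_of_nat: "binom (int a) (int b) = int (a choose b)"
  by (simp add: binom_def)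

lemma binom_pascal:
  assumes "1 \<le> a"
  shows "binom a b = binom (a - 1) (b - 1) + binom (a - 1) b"
proof (cases "1 \<le> b")
  case True
  define p where "p = nat (a - 1)"
  define q where "q = nat (b - 1)"
  have "a = int (Suc p)" "a - 1 = int p" "b = int (Suc q)" "b - 1 = int q"
    using True assms by (auto simp: p_def q_def)
  then show ?thesis by (simp only: binom_of_nat binomial_Suc_Suc of_nat_add)
next
  case False
  then show ?thesis using assms by (auto simp: binom_def)
qed

lemma binom_absorption: "b * binom a b = a * binom (a - 1) (b - 1)"
proof (cases "1 \<le> b \<and> 1 \<le> a")
  case True
  define p where "p = nat (a - 1)"
  define q where "q = nat (b - 1)"
  have eqs: "a = int (Suc p)" "a - 1 = int p" "b = int (Suc q)" "b - 1 = int q"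
    using True by (auto simp: p_def q_def)
  have "int (Suc q) * int (Suc p choose Suc q) = int (Suc p) * int (p choose q)"
    by (metis Suc_times_binomial_eq mult.commute of_nat_mult)
  then show ?thesis unfolding eqs(2,4) unfolding eqs(1,3) binom_of_nat .
next
  case False
  then show ?thesis by (auto simp: binom_def)
qed

text \<open>Termwise Pascal: only the first binomial depends on \<open>i + j\<close>. The rule fails
  for \<open>binom 0 0\<close>, hence the bound.\<close>

lemma c_pascal:
  assumes "1 \<le> i + j - k"
  shows "c m n k i j = c m n k (i - 1) j + c m n k i (j - 1)"
proof -
  have "binom (i + j - k) (i - l) = binom (i - 1 + j - k) (i - 1 - l) + binom (i + (j - 1) - k) (i - l)" for l
    using binom_pascal[OF assms, of "i - l"] by (simp add: algebra_simps)
  then show ?thesis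
    unfolding c_def by (simp add: sum.distrib algebra_simps)
qed

lemma c_negative_row: "i < 0 \<Longrightarrow> c m n k i j = 0"
  unfolding c_def by (intro sum.neutral) (auto simp: binom_def)

lemma c_negative_col: "j < 0 \<Longrightarrow> c m n k i j = 0"
  unfolding c_def by (intro sum.neutral) (auto simp: binom_def)

text \<open>On the antidiagonal \<open>i + j = k\<close> the first binomial is
  \<open>binom 0 (i - l)\<close>, so only \<open>l = i\<close> survives.\<close>

lemma c_singular_vector:
  assumes "0 \<le> i" "i \<le> k"
  shows "c m n k i (k - i) = (-1) ^ nat i * binom (m - i) (k - i) * binom (n - k + i) i"
proof -
  have "c m n k i (k - i) = (\<Sum>l\<in>{0..k}. if l = i
     then (-1) ^ nat i * binom (m - i) (k - i) * binom (n - k + i) i else 0)"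
    unfolding c_def by (intro sum.cong) (auto simp: binom_def)
  then show ?thesis using assms by simp
qed

text \<open>This is \<open>E w = 0\<close>, the base case of the raising recurrence. Outside
  \<open>0 \<le> i < k\<close> each term has a zero factor.\<close>

lemma c_singular_recurrence:
  assumes "j = k - 1 - i"
  shows "(i + 1) * (m - i) * c m n k (i + 1) j + (j + 1) * (n - j) * c m n k i (j + 1) = 0"
proof -
  consider "i < 0" | "0 \<le> i" "i < k" | "k \<le> i" by linarith
  then show ?thesis
  proof cases
    case 1
    then show ?thesis
      by (cases "i = -1") (auto simp: c_negative_row)
  next
    case 2
    define A where "A = binom (m - (i + 1)) (k - (i + 1))"
    define B where "B = binom (n - k + i) i"
    have A: "(k - i) * binom (m - i) (k - i) = (m - i) * A"
      using binom_absorption[of "k - i" "m - i"] by (simp add: A_def algebra_simps)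
    have B: "(i + 1) * binom (n - k + (i + 1)) (i + 1) = (n - k + i + 1) * B"
      using binom_absorption[of "i + 1" "n - k + (i + 1)"] by (simp add: B_def algebra_simps)
    have j: "j = k - (i + 1)" using assms by simp
    have c1: "c m n k (i + 1) j = - ((-1) ^ nat i * A * binom (n - k + (i + 1)) (i + 1))"
      using c_singular_vector[of "i + 1" k m n] 2
      by (simp add: A_def j nat_add_distrib)
    have c0: "c m n k i (j + 1) = (-1) ^ nat i * binom (m - i) (k - i) * B"
      using c_singular_vector[of i k m n] 2 by (simp add: B_def j)
    have "(i + 1) * (m - i) * c m n k (i + 1) j
        = - ((-1) ^ nat i * ((m - i) * A) * ((i + 1) * binom (n - k + (i + 1)) (i + 1)))"
      unfolding c1 by (simp only: mult_ac mult_minus_right)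
    also have "\<dots> = - ((-1) ^ nat i * ((k - i) * binom (m - i) (k - i)) * ((n - k + i + 1) * B))"
      unfolding A B ..
    also have "\<dots> = - ((j + 1) * (n - j) * c m n k i (j + 1))"
      unfolding c0 unfolding assms by (simp add: algebra_simps)
    finally show ?thesis by simp
  next
    case 3
    then show ?thesis using assms
      by (cases "i = k") (auto simp: c_negative_col)
  qed
qed

text \<open>This is \<open>E F\<^sup>s w = s (m + n - 2 k - s + 1) F\<^sup>s\<^sup>-\<^sup>1 w\<close>, read off coefficientwise.\<close>

lemma c_raising:
  assumes "i + j + 1 - k = int s"
  shows "(i + 1) * (m - i) * c m n k (i + 1) j + (j + 1) * (n - j) * c m n k i (j + 1)
       = int s * (m + n - 2 * k - int s + 1) * c m n k i j"
  using assms
proof (induction s arbitrary: i j)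
  case 0
  then have "j = k - 1 - i" by simp
  from c_singular_recurrence[OF this] show ?case by simp
next
  case (Suc s)
  let ?c = "c m n k" and ?t = "int s * (m + n - 2 * k - int s + 1)"
  have s: "int s = i + j - k" using Suc.prems by simp
  have up: "?c (i + 1) j = ?c i j + ?c (i + 1) (j - 1)" "?c i (j + 1) = ?c (i - 1) (j + 1) + ?c i j"
    using c_pascal[of "i + 1" j] c_pascal[of i "j + 1"] s by auto
  have IH1: "i * (m - (i - 1)) * ?c i j + (j + 1) * (n - j) * ?c (i - 1) (j + 1) = ?t * ?c (i - 1) j"
    using Suc.IH[of "i - 1" j] s by simp
  have IH2: "(i + 1) * (m - i) * ?c (i + 1) (j - 1) + j * (n - (j - 1)) * ?c i j = ?t * ?c i (j - 1)"
    using Suc.IH[of i "j - 1"] s by simp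
  have down: "?t * ?c (i - 1) j + ?t * ?c i (j - 1) = ?t * ?c i j"
  proof (cases "s = 0")
    case False
    then have "?c i j = ?c (i - 1) j + ?c i (j - 1)" using s by (intro c_pascal) linarith
    then show ?thesis by (simp add: distrib_left)
  qed simp
  \<comment> \<open>This is \<open>E F = F E + H\<close>: the leftover
    \<open>m + n - 2 * i - 2 * j\<close> is the weight of the basis vector indexed by
    \<open>(i, j)\<close>.\<close>
  have "(i + 1) * (m - i) * ?c (i + 1) j + (j + 1) * (n - j) * ?c i (j + 1)
      = (m + n - 2 * i - 2 * j) * ?c i j
        + (i * (m - (i - 1)) * ?c i j + (j + 1) * (n - j) * ?c (i - 1) (j + 1))
        + ((i + 1) * (m - i) * ?c (i + 1) (j - 1) + j * (n - (j - 1)) * ?c i j)"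
    unfolding up by (simp add: algebra_simps)
  also have "\<dots> = (m + n - 2 * i - 2 * j) * ?c i j + ?t * ?c i j"
    unfolding IH1 IH2 using down by simp
  also have "\<dots> = int (Suc s) * (m + n - 2 * k - int (Suc s) + 1) * ?c i j"
  proof -
    have k: "k = i + j - int s" using s by simp
    show ?thesis unfolding k by (simp add: algebra_simps)
  qed
  finally show ?case .
qed

lemma c_top_row_nonzero:
  assumes "0 \<le> k" "k \<le> m" "k \<le> n" "k \<le> j"
  shows "c m n k 0 j \<noteq> 0"
proof -
  have "c m n k 0 j = (\<Sum>l\<in>{0..k}. if l = 0 then binom m k else 0)"
    unfolding c_def using assms by (intro sum.cong) (auto simp: binom_def)
  then show ?thesis using assms by (simp add: binom_def nat_mono)
qed

text \<open>For \<open>j = n\<close> the second term of the raising recurrence vanishes, and its other two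
  coefficients are positive as long as the column stays in range.\<close>

lemma c_right_edge_nonzero:
  assumes "0 \<le> k" "k \<le> m" "k \<le> n" "int i \<le> m - k"
  shows "c m n k (int i) n \<noteq> 0"
  using assms(4)
proof (induction i)
  case 0
  then show ?case using c_top_row_nonzero assms by simp
next
  case (Suc i)
  define s where "s = nat (int i + n + 1 - k)"
  have s: "int i + n + 1 - k = int s" using assms by (simp add: s_def)
  have "(int i + 1) * (m - int i) * c m n k (int i + 1) n
      = int s * (m + n - 2 * k - int s + 1) * c m n k (int i) n"
    using c_raising[OF s, of m n] by simp
  moreover have "int s * (m + n - 2 * k - int s + 1) \<noteq> 0"
    using s Suc.prems assms by auto
  ultimately show ?case using Suc by (auto simp: add.commute)
qed

text \<open>\<open>j\<close> must vary in the induction: a zero pair moves one row up and to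
  \<open>j + 1\<close>. The sum of the indices is unchanged, so the column bounds persist.\<close>

lemma no_zero_pair:
  assumes "0 \<le> k" "k \<le> m" "k \<le> n"
    and "int i < m" "0 \<le> j" "j \<le> n" "1 \<le> int (Suc i) + j - k" "int (Suc i) + j - k \<le> m + n - 2 * k"
    and "c m n k (int (Suc i)) j = 0"
  shows "c m n k (int i) j \<noteq> 0"
  using assms(4-)
proof (induction i arbitrary: j)
  case 0
  then show ?case using c_top_row_nonzero[of k m n j] assms by simp
next
  case (Suc i)
  show ?case
  proof
    assume z: "c m n k (int (Suc i)) j = 0"
    \<comment> \<open>For \<open>j = n\<close> the column bound reads
      \<open>Suc (Suc i) \<le> m - k\<close>, so the assumed zero would lie on the nonvanishing
      edge.\<close>
    have "j \<noteq> n"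
      using c_right_edge_nonzero[of k m n "Suc (Suc i)"] Suc.prems assms(1-3) by auto
    define s where "s = nat (int (Suc i) + j + 1 - k)"
    have s: "int (Suc i) + j + 1 - k = int s" using Suc.prems by (simp add: s_def)
    have "c m n k (int (Suc i) + 1) j = 0" using Suc.prems(6) by (simp add: add_ac)
    then have "(j + 1) * (n - j) * c m n k (int (Suc i)) (j + 1) = 0"
      using c_raising[OF s, of m n] z by simp
    then have z': "c m n k (int (Suc i)) (j + 1) = 0"
      using Suc.prems \<open>j \<noteq> n\<close> by auto
    moreover have "c m n k (int (Suc i)) (j + 1) = c m n k (int i) (j + 1) + c m n k (int (Suc i)) j"
      using c_pascal[of "int (Suc i)" "j + 1" k m n] Suc.prems by simp
    ultimately show False
      using Suc.IH[of "j + 1"] z Suc.prems \<open>j \<noteq> n\<close> by simp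
  qed
qed

lemma no_zero_pair_int:
  assumes "0 \<le> k" "k \<le> m" "k \<le> n"
    and "1 \<le> i" "i \<le> m" "0 \<le> j" "j \<le> n" "1 \<le> i + j - k" "i + j - k \<le> m + n - 2 * k"
    and "c m n k i j = 0"
  shows "c m n k (i - 1) j \<noteq> 0"
proof -
  have "i = int (Suc (nat (i - 1)))" using assms by simp
  then show ?thesis using no_zero_pair[of k m n "nat (i - 1)" j] assms by auto
qed

theorem proposition9:
  fixes m n k i j :: int
  assumes "0 \<le> k" and "k \<le> min m n"
    and "proper_zero m n k i j"
  shows "(\<forall>r s. r < dim_row (M m n k) \<and> s < dim_col (M m n k) \<and>
             adjacent (nat i, nat (i + j - k)) (r, s) \<and> M m n k $$ (r, s) = 0 \<longrightarrow>
             (int r = i - 1 \<and> int s = i + j - k + 1) \<or> (int r = i + 1 \<and> int s = i + j - k - 1))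
       \<and> c m n k (i - 1) j \<noteq> 0 \<and> c m n k (i - 1) (j + 1) \<noteq> 0
       \<and> c m n k i (j - 1) \<noteq> 0 \<and> c m n k i (j + 1) \<noteq> 0
       \<and> c m n k (i + 1) (j - 1) \<noteq> 0 \<and> c m n k (i + 1) j \<noteq> 0"
proof -
  have k: "0 \<le> k" "k \<le> m" "k \<le> n" using assms by auto
  have rng: "0 < i" "i < m" "0 < j" "j < n" "0 < i + j - k" "i + j - k < m + n - 2 * k"
    and z: "c m n k i j = 0" using assms(3) by (auto simp: proper_zero_def)
  note pair = no_zero_pair_int[OF k]
  have c1: "c m n k (i - 1) j \<noteq> 0" using pair[of i j] rng z by simp
  have c2: "c m n k i (j - 1) \<noteq> 0" using c_pascal[of i j k m n] c1 rng z by simp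
  have c3: "c m n k (i + 1) j \<noteq> 0" using pair[of "i + 1" j] rng z by auto
  have c4: "c m n k (i + 1) (j - 1) \<noteq> 0" using c_pascal[of "i + 1" j k m n] c3 rng z by simp
  \<comment> \<open>By the central zero these two entries agree, so if one vanished they would form
    a forbidden pair.\<close>
  have p5: "c m n k i (j + 1) = c m n k (i - 1) (j + 1)"
    using c_pascal[of i "j + 1" k m n] rng z by simp
  have c5: "c m n k i (j + 1) \<noteq> 0" using pair[of i "j + 1"] p5 rng by auto
  have c6: "c m n k (i - 1) (j + 1) \<noteq> 0" using c5 p5 by simp
  have "(int r = i - 1 \<and> int s = i + j - k + 1) \<or> (int r = i + 1 \<and> int s = i + j - k - 1)"
    if rs: "r < dim_row (M m n k)" "s < dim_col (M m n k)"
      "adjacent (nat i, nat (i + j - k)) (r, s)" "M m n k $$ (r, s) = 0" for r s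
  proof (rule ccontr)
    assume contra: "\<not> ?thesis"
    define a where "a = int r - i"
    define b where "b = int s - (i + j - k)"
    have ab: "int r = i + a" "int s = i + j - k + b" by (simp_all add: a_def b_def)
    have "a = - 1 \<or> a = 0 \<or> a = 1" "b = - 1 \<or> b = 0 \<or> b = 1"
      using rs(3) rng unfolding adjacent_def a_def b_def by simp_all linarith+
    moreover have "\<not> (a = 0 \<and> b = 0)"
      using rs(3) rng unfolding adjacent_def a_def b_def by auto
    moreover have "\<not> (a = - 1 \<and> b = 1)" "\<not> (a = 1 \<and> b = - 1)"
      using contra by (auto simp: ab)
    ultimately have six: "a = - 1 \<and> b = - 1 \<or> a = - 1 \<and> b = 0 \<or> a = 0 \<and> b = - 1
      \<or> a = 0 \<and> b = 1 \<or> a = 1 \<and> b = 0 \<or> a = 1 \<and> b = 1"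
      by blast
    \<comment> \<open>In the six cases \<open>b - a\<close> is at most 1 in absolute value and
      \<open>0 < j < n\<close>, so no corner triangle is reached.\<close>
    have "0 \<le> j + b - a" "j + b - a \<le> n" using six rng by auto
    moreover have j: "int s - int r + k = j + b - a" by (simp add: ab)
    moreover have "M m n k $$ (r, s) = (if 0 \<le> int s - int r + k \<and> int s - int r + k \<le> n
        then c m n k (int r) (int s - int r + k) else 0)"
      using rs(1,2) by (simp add: M_def Let_def)
    ultimately have "M m n k $$ (r, s) = c m n k (i + a) (j + b - a)"
      unfolding j unfolding ab(1) by simp
    then have "c m n k (i + a) (j + b - a) = 0" using rs(4) by simp
    with six show False using c1 c2 c3 c4 c5 c6 by auto
  qed
  then show ?thesis using c1 c2 c3 c4 c5 c6 by blast
qed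

end
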